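(* Let $\mathbf{m}=(m_1,\dots,m_n)$ be a list of positive integers. Then there is a real first-locus configuration $\mathcal{A}_{\mathbf{m}}$ in $\mathbb{C}^2$ whose cyclic list of multiplicities is $\mathbf{m}$, and $\mathcal{A}_{\mathbf{m}}$ is unique up to rotation.
   Context: $\langle\cdot,\cdot\rangle$ denotes the standard $\mathbb{C}$-bilinear inner product on $\mathbb{C}^2$. An arrangement $\mathcal{A}$ in $\mathbb{C}^2$ is a finite collection of distinct lines $H_1,\dots,H_n$ through the origin, with positive integer multiplicities $m_1,\dots,m_n$; for each $i$ a normal vector $\alpha_i$ is chosen, $H_i=\{x:\langle\alpha_i,x\rangle=0\}$, and it is assumed that $\langle\alpha_i,\alpha_i\rangle\neq0$. First-locus configuration: $\mathcal{A}$ is a first-locus configuration if for every $i$, $$\sum_{j\neq i}\frac{m_j(m_j+1)\langle\alpha_j,\alpha_j\rangle\langle\alpha_j,\alpha_i\rangle}{\langle\alpha_j,x\rangle^{3}}=0$$ for all $x\in H_i$ at which the expression is defined (i.e. $x\notin H_j$ for $j\neq i$). This does not depend on the choice of the $\alpha_i$. Real: $\mathcal{A}$ is real if all $\alpha_i$ may be chosen with real coordinates. Then for each $i$ there is a unique $\theta_i\in\mathbb{R}/2\pi\mathbb{Z}$ such that $\alpha_i$ is a multiple of $(\cos(\theta_i/2),\sin(\theta_i/2))$. Cyclic list of multiplicities: a real arrangement has cyclic list of multiplicities $\mathbf{m}=(m_1,\dots,m_n)$ if its $n$ lines can be labelled $H_1,\dots,H_n$ so that $H_i$ has multiplicity $m_i$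 and $(\theta_1,\dots,\theta_n)$ is cyclically ordered, meaning that, with representatives of the $\theta_i$ in $[0,2\pi)$, there is some $i$ with $\theta_i<\theta_{i+1}<\dots<\theta_n<\theta_1<\dots<\theta_{i-1}$. Unique up to rotation: any two such arrangements are carried to each other (lines with multiplicities) by a rotation of $\mathbb{R}^2$, extended to $\mathbb{C}^2$; equivalently, a simultaneous translation of all $\theta_i$ in $\mathbb{R}/2\pi\mathbb{Z}$. *)

theory Defs
  imports "HOL-Analysis.Analysis"
begin

text \<open>\<^const>\<open>scalar_product\<close> is the bilinear product on \<open>complex^2\<close>, without conjugation
  (unlike the real inner product \<open>\<bullet>\<close>).\<close>

definition is_normal :: "complex^2 \<Rightarrow> (complex^2) set \<Rightarrow> bool" where
  "is_normal a H \<longleftrightarrow> a \<noteq> 0 \<and> H = {x. scalar_product a x = 0}"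

text \<open>A collection of distinct lines with positive multiplicities is encoded by its multiplicity
  function, which is \<open>0\<close> exactly at the sets that do not belong to the collection.\<close>

type_synonym multiplicities = "(complex^2) set \<Rightarrow> nat"

definition lines_of :: "multiplicities \<Rightarrow> (complex^2) set set" where
  "lines_of A = {H. A H \<noteq> 0}"

definition arrangement :: "multiplicities \<Rightarrow> bool" where
  "arrangement A \<longleftrightarrow> finite (lines_of A) \<and>
     (\<forall>H\<in>lines_of A. \<exists>a. is_normal a H \<and> scalar_product a a \<noteq> 0)"

definition normal_choice :: "multiplicities \<Rightarrow> ((complex^2) set \<Rightarrow> complex^2) \<Rightarrow> bool" where
  "normal_choice A \<alpha> \<longleftrightarrow> (\<forall>H\<in>lines_of A. is_normal (\<alpha> H) H)"

definition first_locus_wrt ::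
    "multiplicities \<Rightarrow> ((complex^2) set \<Rightarrow> complex^2) \<Rightarrow> bool" where
  "first_locus_wrt A \<alpha> \<longleftrightarrow>
     (\<forall>H\<in>lines_of A. \<forall>x\<in>H. (\<forall>K\<in>lines_of A - {H}. x \<notin> K) \<longrightarrow>
        (\<Sum>K\<in>lines_of A - {H}.
           of_nat (A K * (A K + 1)) * scalar_product (\<alpha> K) (\<alpha> K) * scalar_product (\<alpha> K) (\<alpha> H)
             / scalar_product (\<alpha> K) x ^ 3) = 0)"

definition first_locus_configuration :: "multiplicities \<Rightarrow> bool" where
  "first_locus_configuration A \<longleftrightarrow>
     arrangement A \<and> (\<forall>\<alpha>. normal_choice A \<alpha> \<longrightarrow> first_locus_wrt A \<alpha>)"

definition real_arrangement :: "multiplicities \<Rightarrow> bool" where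
  "real_arrangement A \<longleftrightarrow> arrangement A \<and>
     (\<forall>H\<in>lines_of A. \<exists>a. is_normal a H \<and> (\<forall>i. a $ i \<in> \<real>))"

text \<open>Classes in \<open>\<real>/2\<pi>\<int>\<close> are represented in \<open>[0, 2\<pi>)\<close>.\<close>

definition is_line_angle :: "(complex^2) set \<Rightarrow> real \<Rightarrow> bool" where
  "is_line_angle H \<theta> \<longleftrightarrow> 0 \<le> \<theta> \<and> \<theta> < 2 * pi \<and>
     (\<exists>a c. is_normal a H \<and>
        a = c *s vector [complex_of_real (cos (\<theta> / 2)), complex_of_real (sin (\<theta> / 2))])"

definition line_angle :: "(complex^2) set \<Rightarrow> real" where
  "line_angle H = (THE \<theta>. is_line_angle H \<theta>)"

definition cyclically_ordered :: "real list \<Rightarrow> bool" where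
  "cyclically_ordered ts \<longleftrightarrow> (\<exists>k. sorted_wrt (<) (rotate k ts))"

definition has_cyclic_multiplicities :: "multiplicities \<Rightarrow> nat list \<Rightarrow> bool" where
  "has_cyclic_multiplicities A m \<longleftrightarrow>
     (\<exists>Hs. distinct Hs \<and> set Hs = lines_of A \<and> map A Hs = m \<and>
           cyclically_ordered (map line_angle Hs))"

text \<open>The map on \<open>\<complex>\<^sup>2\<close> extending a real rotation matrix carries \<open>A\<close> to \<open>B\<close>,
  with multiplicities.\<close>

definition rotation_related :: "multiplicities \<Rightarrow> multiplicities \<Rightarrow> bool" where
  "rotation_related A B \<longleftrightarrow>
     (\<exists>Q :: real^2^2. rotation_matrix Q \<and>
        (\<forall>H. B ((\<lambda>x. map_matrix complex_of_real Q *v x) ` H) = A H))"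


lemma scalar_product_2: "scalar_product (a :: complex^2) b = a $ 1 * b $ 1 + a $ 2 * b $ 2"
  by (simp add: scalar_product_def sum_2)

lemma is_normal_unique:
  assumes "is_normal a H" "is_normal b H"
  obtains c where "c \<noteq> 0" "b = c *s a"
proof -
  have a0: "a \<noteq> 0" and b0: "b \<noteq> 0" using assms by (auto simp: is_normal_def)
  have "vector [- (a $ 2), a $ 1] \<in> H"
    using assms(1) by (simp add: is_normal_def scalar_product_2)
  then have e: "b $ 2 * a $ 1 = b $ 1 * a $ 2"
    using assms(2) by (simp add: is_normal_def scalar_product_2)
  have "\<exists>c. b = c *s a"
  proof (cases "a $ 1 = 0")
    case True
    then have "a $ 2 \<noteq> 0" using a0 by (auto simp: vec_eq_iff forall_2)
    then have "b = (b $ 2 / a $ 2) *s a" using e True by (simp add: vec_eq_iff forall_2)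
    then show ?thesis by blast
  next
    case False
    then have "b = (b $ 1 / a $ 1) *s a" using e by (simp add: vec_eq_iff forall_2 field_simps)
    then show ?thesis by blast
  qed
  then show ?thesis using b0 that by fastforce
qed

text \<open>The first-locus condition may be tested on a single choice of normals.\<close>

lemma first_locus_configuration_iff:
  assumes "normal_choice A \<alpha>"
  shows "first_locus_configuration A \<longleftrightarrow> arrangement A \<and> first_locus_wrt A \<alpha>"
proof -
  have "first_locus_wrt A \<beta>" if fl: "first_locus_wrt A \<alpha>" and nb: "normal_choice A \<beta>" for \<beta>
  proof -
    have "\<forall>H\<in>lines_of A. \<exists>c. c \<noteq> 0 \<and> \<beta> H = c *s \<alpha> H"
      using assms nb unfolding normal_choice_def by (meson is_normal_unique)
    then obtain c where c: "\<And>H. H \<in> lines_of A \<Longrightarrow> c H \<noteq> 0 \<and> \<beta> H = c H *s \<alpha> H"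
      by metis
    show ?thesis unfolding first_locus_wrt_def
    proof (intro ballI impI)
      fix H x assume H: "H \<in> lines_of A" "x \<in> H" "\<forall>K\<in>lines_of A - {H}. x \<notin> K"
      let ?t = "\<lambda>\<gamma> K. of_nat (A K * (A K + 1)) * scalar_product (\<gamma> K) (\<gamma> K)
        * scalar_product (\<gamma> K) (\<gamma> H) / scalar_product (\<gamma> K) x ^ 3"
      have "?t \<beta> K = c H * ?t \<alpha> K" if "K \<in> lines_of A - {H}" for K
      proof -
        have cK: "c K \<noteq> 0" "\<beta> K = c K *s \<alpha> K" and bH: "\<beta> H = c H *s \<alpha> H"
          using c that H by auto
        have s: "scalar_product (\<beta> K) (\<beta> K) = c K ^ 2 * scalar_product (\<alpha> K) (\<alpha> K)"
          "scalar_product (\<beta> K) (\<beta> H) = c K * c H * scalar_product (\<alpha> K) (\<alpha> H)"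
          "scalar_product (\<beta> K) x = c K * scalar_product (\<alpha> K) x"
          unfolding cK(2) bH by (simp_all add: scalar_product_2 algebra_simps power2_eq_square)
        show ?thesis unfolding s using cK(1)
          by (simp add: power_mult_distrib power2_eq_square power3_eq_cube ac_simps)
      qed
      then have "(\<Sum>K\<in>lines_of A - {H}. ?t \<beta> K) = c H * (\<Sum>K\<in>lines_of A - {H}. ?t \<alpha> K)"
        unfolding sum_distrib_left by (intro sum.cong refl) blast
      also have "\<dots> = 0" using fl H unfolding first_locus_wrt_def by simp
      finally show "(\<Sum>K\<in>lines_of A - {H}. ?t \<beta> K) = 0" .
    qed
  qed
  then show ?thesis using assms unfolding first_locus_configuration_def by blast
qed

lemma line_angle_ex1:
  assumes n: "is_normal a H" and r: "\<forall>i. a $ i \<in> \<real>"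
  shows "\<exists>!\<theta>. is_line_angle H \<theta>"
proof (rule ex_ex1I)
  obtain p q where pq: "a $ 1 = complex_of_real p" "a $ 2 = complex_of_real q"
    using r by (metis Reals_cases)
  have ne: "Complex p q \<noteq> 0"
    using n pq by (auto simp: is_normal_def vec_eq_iff forall_2 complex_eq_iff)
  define z where "z = Complex p q"
  define R where "R = norm z"
  obtain t where t: "0 \<le> t" "t < 2 * pi" "p = R * cos t" "q = R * sin t"
  proof -
    have "R * cos (Arg2pi z) = p" "R * sin (Arg2pi z) = q"
      using Arg2pi_eq[of z] unfolding R_def
      by (metis z_def Re_rcis complex.sel(1) rcis_def cis_conv_exp,
          metis z_def Im_rcis complex.sel(2) rcis_def cis_conv_exp)
    then show thesis using that[of "Arg2pi z"] Arg2pi[of z] by auto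
  qed
  show "\<exists>\<theta>. is_line_angle H \<theta>"
  proof (cases "t < pi")
    case True
    have "a = complex_of_real R *s vector [complex_of_real (cos (2*t / 2)), complex_of_real (sin (2*t / 2))]"
      using t pq by (simp add: vec_eq_iff forall_2)
    then have "is_line_angle H (2 * t)" unfolding is_line_angle_def using t True n by auto
    then show ?thesis by blast
  next
    case False
    have h: "(2*t - 2*pi) / 2 = t - pi" by simp
    have "a = complex_of_real (- R) *s vector [complex_of_real (cos ((2*t - 2*pi) / 2)), complex_of_real (sin ((2*t - 2*pi) / 2))]"
      unfolding h using t pq by (simp add: vec_eq_iff forall_2 cos_diff sin_diff)
    moreover have "0 \<le> 2*t - 2*pi" "2*t - 2*pi < 2*pi" using t False by auto
    ultimately have "is_line_angle H (2*t - 2*pi)" unfolding is_line_angle_def using n by blast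
    then show ?thesis by blast
  qed
next
  fix u v assume "is_line_angle H u" "is_line_angle H v"
  then obtain a b c d where u: "0 \<le> u" "u < 2 * pi" "is_normal a H"
      "a = c *s vector [complex_of_real (cos (u / 2)), complex_of_real (sin (u / 2))]"
    and v: "0 \<le> v" "v < 2 * pi" "is_normal b H"
      "b = d *s vector [complex_of_real (cos (v / 2)), complex_of_real (sin (v / 2))]"
    unfolding is_line_angle_def by blast
  obtain e where e: "b = e *s a" using is_normal_unique u v by metis
  have d0: "d \<noteq> 0" using v by (auto simp: is_normal_def)
  have "b $ 1 * a $ 2 = b $ 2 * a $ 1" by (simp add: e)
  moreover have "c \<noteq> 0" using u by (auto simp: is_normal_def)
  ultimately have "complex_of_real (cos (v/2)) * complex_of_real (sin (u/2)) = complex_of_real (sin (v/2)) * complex_of_real (cos (u/2))"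
    using d0 by (simp add: u(4) v(4) mult.assoc mult.left_commute)
  then have "cos (v/2) * sin (u/2) = sin (v/2) * cos (u/2)"
    by (metis of_real_mult of_real_eq_iff)
  then have s: "sin (u/2 - v/2) = 0" by (simp add: sin_diff mult.commute)
  have "u/2 - v/2 = 0"
  proof (rule sin_eq_0_pi[OF _ _ s])
    show "- pi < u/2 - v/2" "u/2 - v/2 < pi" using u(1,2) v(1,2) by (simp_all add: field_simps)
  qed
  then show "u = v" by simp
qed

end

theory Submission
  imports Defs
begin

text \<open>With normals \<open>(cos (\<theta>\<^sub>i / 2), sin (\<theta>\<^sub>i / 2))\<close> and \<open>k\<^sub>i = m\<^sub>i (m\<^sub>i + 1)\<close>, the
  first-locus conditions say that the angles form a critical point of the energy
  \<open>\<Sum> k\<^sub>i k\<^sub>j / sin\<^sup>2 ((\<theta>\<^sub>j - \<theta>\<^sub>i) / 2)\<close> of repelling particles on a circle. On the convex set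
  \<open>\<theta>\<^sub>1 < \<dots> < \<theta>\<^sub>n < \<theta>\<^sub>1 + 2\<pi>\<close> the energy blows up at the boundary, so it has a minimum, and it is
  strictly convex modulo simultaneous translation, so the critical point is unique up to rotation.\<close>

subsection \<open>Equilibria of repelling particles on a circle\<close>

text \<open>Minus the derivative of \<open>potential\<close>. On the line with angle
  \<open>s\<close>, the first-locus term of a line with angle \<open>s + t\<close> is proportional
  to it.\<close>

definition force :: "real \<Rightarrow> real" where
  "force t = cos (t / 2) / sin (t / 2) ^ 3"

definition potential :: "real \<Rightarrow> real" where
  "potential t = 1 / sin (t / 2) ^ 2"

text \<open>Each unordered pair is counted twice, hence the factor 2 in the gradient below.\<close>

definition energy :: "nat \<Rightarrow> (nat \<Rightarrow> real) \<Rightarrow> (nat \<Rightarrow> real) \<Rightarrow> real" where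
  "energy n k u = (\<Sum>i<n. \<Sum>j<n. k i * k j * potential (u j - u i))"

text \<open>The diagonal terms below vanish because \<open>force 0 = 1 / 0 = 0\<close>; likewise \<open>potential 0 = 0\<close>.\<close>

definition balanced :: "nat \<Rightarrow> (nat \<Rightarrow> real) \<Rightarrow> (nat \<Rightarrow> real) \<Rightarrow> bool" where
  "balanced n k u \<longleftrightarrow> (\<forall>i<n. (\<Sum>j<n. k j * force (u j - u i)) = 0)"

text \<open>Only differences enter, so the condition is invariant under translation and the angles
  need not lie in [0, 2 pi).\<close>

definition spread :: "nat \<Rightarrow> (nat \<Rightarrow> real) \<Rightarrow> bool" where
  "spread n u \<longleftrightarrow> (\<forall>i j. i < j \<longrightarrow> j < n \<longrightarrow> 0 < u j - u i \<and> u j - u i < 2 * pi)"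

lemma spreadD: "spread n u \<Longrightarrow> i < j \<Longrightarrow> j < n \<Longrightarrow> 0 < u j - u i \<and> u j - u i < 2 * pi"
  by (auto simp: spread_def)

lemma force_0 [simp]: "force 0 = 0"
  by (simp add: force_def)

lemma potential_0 [simp]: "potential 0 = 0"
  by (simp add: potential_def)

lemma force_swap: "force (a - b) = - force (b - a)"
proof -
  have "(a - b) / 2 = - ((b - a) / 2)" by (simp add: field_simps)
  then show ?thesis unfolding force_def by (simp only: sin_minus cos_minus) simp
qed

lemma potential_nonneg: "0 \<le> potential t"
  by (simp add: potential_def)

lemma sin_half_pos: "0 < t \<Longrightarrow> t < 2 * pi \<Longrightarrow> 0 < sin (t / 2)"
  by (intro sin_gt_zero) auto

lemma sin_half_nonzero:
  assumes "spread n u" "i < n" "j < n" "i \<noteq> j"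
  shows "sin ((u j - u i) / 2) \<noteq> 0"
proof (cases "i < j")
  case True
  then show ?thesis using sin_half_pos[of "u j - u i"] spreadD[OF assms(1)] assms(3) by fastforce
next
  case False
  then have "0 < sin ((u i - u j) / 2)"
    using sin_half_pos[of "u i - u j"] spreadD[OF assms(1), of j i] assms by fastforce
  moreover have "sin ((u j - u i) / 2) = - sin ((u i - u j) / 2)"
    by (metis minus_diff_eq minus_divide_left sin_minus)
  ultimately show ?thesis by simp
qed

section \<open>Monotonicity of the force and uniqueness of equilibria\<close>

text \<open>With \<open>y = cot (x / 2)\<close> the force is \<open>y + y ^ 3\<close>, which
  increases in \<open>y\<close>, and the cotangent decreases on (0, pi).\<close>

lemma force_strict_antimono:
  assumes "0 < s" "s < t" "t < 2 * pi"
  shows "force t < force s"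
proof -
  have ps: "0 < sin (s / 2)" and pt: "0 < sin (t / 2)"
    using assms by (auto intro!: sin_half_pos)
  define c d where "c = cos (s / 2) / sin (s / 2)" and "d = cos (t / 2) / sin (t / 2)"
  have f: "force x = y * (1 + y ^ 2)" if "0 < sin (x / 2)" "y = cos (x / 2) / sin (x / 2)" for x y
  proof -
    have "1 + y ^ 2 = 1 / sin (x / 2) ^ 2"
      using that(1) sin_cos_squared_add[of "x / 2"]
      unfolding that(2) by (simp add: field_simps power_divide)
    then show ?thesis unfolding that(2) force_def by (simp add: power2_eq_square power3_eq_cube)
  qed
  have "0 < sin (t / 2 - s / 2)"
    using assms by (intro sin_gt_zero) auto
  then have "d < c"
    using ps pt unfolding c_def d_def sin_diff by (simp add: divide_simps mult.commute)
  \<comment> \<open>This product is \<open>(c + c ^ 3) - (d + d ^ 3)\<close>; its quadratic form is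
    nonnegative by completing the square.\<close>
  have "0 < (c - d) * (1 + (c ^ 2 + c * d + d ^ 2))"
  proof -
    have "0 \<le> (c + d / 2) ^ 2 + 3 / 4 * d ^ 2" by simp
    also have "\<dots> = c ^ 2 + c * d + d ^ 2" by (simp add: power2_eq_square algebra_simps)
    finally show ?thesis using \<open>d < c\<close> by (intro mult_pos_pos) auto
  qed
  then show ?thesis
    unfolding f[OF ps c_def] f[OF pt d_def] by (simp add: algebra_simps power2_eq_square)
qed

text \<open>Strict monotonicity of the gradient of the energy, paired with the displacement.\<close>

lemma balanced_unique:
  assumes k: "\<And>i. i < n \<Longrightarrow> 0 < k i"
    and u: "spread n u" "balanced n k u" and v: "spread n v" "balanced n k v"
    and ij: "i < n" "j < n"
  shows "v i - u i = v j - u j"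
proof -
  define w where "w i = u i - v i" for i
  define G where "G i j = force (u j - u i) - force (v j - v i)" for i j
  have anti: "G j i = - G i j" for i j
    unfolding G_def by (subst (1 2) force_swap) simp
  \<comment> \<open>\<open>S\<close> pairs the difference of the two force fields with the
    displacement \<open>w\<close>; it vanishes because both configurations are balanced.\<close>
  define S where "S = (\<Sum>i<n. \<Sum>j<n. k i * k j * w i * G i j)"
  have "S = (\<Sum>i<n. k i * w i * ((\<Sum>j<n. k j * force (u j - u i)) - (\<Sum>j<n. k j * force (v j - v i))))"
    unfolding S_def G_def
    by (intro sum.cong refl) (simp add: sum_distrib_left sum_subtractf[symmetric] algebra_simps)
  then have S0: "S = 0" using u v by (simp add: balanced_def)
  \<comment> \<open>Exchanging the indices and using the antisymmetry of \<open>G\<close> turns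
    \<open>S + S\<close> into a sum over displacement differences, whose terms have a definite
    sign.\<close>
  have "S = (\<Sum>i<n. \<Sum>j<n. k i * k j * w j * G j i)"
    unfolding S_def by (subst sum.swap) (simp add: ac_simps)
  then have "S + S = (\<Sum>i<n. \<Sum>j<n. k i * k j * ((w i - w j) * G i j))"
    by (subst (asm) anti, subst S_def)
      (simp add: sum.distrib[symmetric] sum_negf[symmetric] algebra_simps)
  then have sum0: "(\<Sum>i<n. \<Sum>j<n. k i * k j * ((w i - w j) * G i j)) = 0" using S0 by simp
  have lt: "0 \<le> (w i - w j) * G i j \<and> (w i \<noteq> w j \<longrightarrow> 0 < (w i - w j) * G i j)"
    if "i < j" "j < n" for i j
  proof -
    \<comment> \<open>This is the growth of the gap from \<open>u\<close> to \<open>v\<close>. The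
      force decreases with the gap, so \<open>G i j\<close> has the same sign.\<close>
    have d: "w i - w j = (v j - v i) - (u j - u i)" by (simp add: w_def)
    consider "u j - u i = v j - v i" | "u j - u i < v j - v i" | "v j - v i < u j - u i" by linarith
    then show ?thesis
    proof cases
      case 1
      then show ?thesis by (simp add: G_def d w_def)
    next
      case 2
      then have "0 < G i j" "0 < w i - w j" unfolding G_def d
        using force_strict_antimono[of "u j - u i" "v j - v i"]
          spreadD[OF u(1) that] spreadD[OF v(1) that] by auto
      then show ?thesis by simp
    next
      case 3
      then have "G i j < 0" "w i - w j < 0" unfolding G_def d
        using force_strict_antimono[of "v j - v i" "u j - u i"]
          spreadD[OF u(1) that] spreadD[OF v(1) that] by auto
      then show ?thesis by (simp add: mult_neg_neg less_imp_le)
    qed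
  qed
  have pos: "0 \<le> (w i - w j) * G i j \<and> (w i \<noteq> w j \<longrightarrow> 0 < (w i - w j) * G i j)"
    if "i < n" "j < n" for i j
  proof -
    consider "i < j" | "j < i" | "i = j" by linarith
    then show ?thesis
    proof cases
      case 2
      have "(w i - w j) * G i j = (w j - w i) * G j i" by (subst anti) (simp add: algebra_simps)
      then show ?thesis using lt[OF 2 that(1)] by auto
    qed (use lt that in auto)
  qed
  have "k i * k j * ((w i - w j) * G i j) = 0"
  proof -
    have nn: "0 \<le> k i * k j * ((w i - w j) * G i j)" if "i < n" "j < n" for i j
      using k[OF that(1)] k[OF that(2)] pos[OF that]
      by (metis mult_nonneg_nonneg less_imp_le)
    have "(\<Sum>j<n. k i * k j * ((w i - w j) * G i j)) = 0"
      using sum0 ij nn by (subst (asm) sum_nonneg_eq_0_iff) (auto intro!: sum_nonneg)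
    then show ?thesis using ij nn by (subst (asm) sum_nonneg_eq_0_iff) auto
  qed
  then show ?thesis using k[OF ij(1)] k[OF ij(2)] pos[OF ij] by (auto simp: w_def)
qed

section \<open>Gradient of the energy and existence of equilibria\<close>

lemma has_real_derivative_potential:
  assumes "sin (t / 2) \<noteq> 0"
  shows "(potential has_real_derivative - force t) (at t)"
proof -
  have "((\<lambda>t. 1 / sin (t / 2) ^ 2) has_real_derivative - force t) (at t)"
    unfolding force_def
    by (rule derivative_eq_intros refl | use assms in \<open>simp add: field_simps power2_eq_square power3_eq_cube\<close>)+
  then show ?thesis by (simp add: potential_def[abs_def])
qed

text \<open>Moving particle \<open>a\<close> changes the terms with \<open>i = a\<close> and those
  with \<open>j = a\<close>; by antisymmetry of the force both contribute equally. Critical points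
  for positive weights are thus the balanced configurations.\<close>

lemma has_real_derivative_energy:
  assumes u: "spread n u" and a: "a < n"
  shows "((\<lambda>h. energy n k (u(a := u a + h))) has_real_derivative
           2 * k a * (\<Sum>j<n. k j * force (u j - u a))) (at 0)"
proof -
  \<comment> \<open>Writing the moved configuration as \<open>u i + \<delta> i * h\<close> lets all
    pairs be differentiated by one formula.\<close>
  define \<delta> where "\<delta> i = (if i = a then 1 else 0 :: real)" for i
  have upd: "(u(a := u a + h)) i = u i + \<delta> i * h" for h i by (simp add: \<delta>_def)
  have deriv_term: "((\<lambda>h. potential (u j + \<delta> j * h - (u i + \<delta> i * h))) has_real_derivative
      force (u j - u i) * (\<delta> i - \<delta> j)) (at 0)" if "i < n" "j < n" for i j
  proof (cases "i = j")
    case False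
    have "((\<lambda>h. potential (u j + \<delta> j * h - (u i + \<delta> i * h))) has_real_derivative
        - force (u j - u i) * (\<delta> j - \<delta> i)) (at 0)"
      by (rule DERIV_chain2[of potential])
        (use sin_half_nonzero[OF u that False] in
          \<open>auto intro!: has_real_derivative_potential derivative_eq_intros\<close>)
    then show ?thesis by (simp add: algebra_simps)
  qed simp
  have "((\<lambda>h. energy n k (u(a := u a + h))) has_real_derivative
      (\<Sum>i<n. \<Sum>j<n. k i * k j * (force (u j - u i) * (\<delta> i - \<delta> j)))) (at 0)"
    unfolding energy_def upd by (intro DERIV_sum DERIV_cmult deriv_term) auto
  moreover have "(\<Sum>i<n. \<Sum>j<n. k i * k j * (force (u j - u i) * (\<delta> i - \<delta> j)))
      = 2 * k a * (\<Sum>j<n. k j * force (u j - u a))"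
  proof -
    have d: "(\<Sum>i<n. \<delta> i * f i) = f a" for f :: "nat \<Rightarrow> real"
      using a by (simp add: \<delta>_def if_distrib[of "\<lambda>x. x * _"] cong: if_cong)
    have "(\<Sum>i<n. \<Sum>j<n. k i * k j * (force (u j - u i) * (\<delta> i - \<delta> j)))
      = (\<Sum>i<n. \<delta> i * (\<Sum>j<n. k i * k j * force (u j - u i)))
        - (\<Sum>i<n. \<Sum>j<n. \<delta> j * (k i * k j * force (u j - u i)))"
      by (simp add: sum_subtractf[symmetric] sum_distrib_left algebra_simps)
    also have "(\<Sum>i<n. \<Sum>j<n. \<delta> j * (k i * k j * force (u j - u i)))
      = (\<Sum>i<n. k i * k a * force (u a - u i))"
      by (simp add: d)
    also have "\<dots> = - (\<Sum>i<n. k a * k i * force (u i - u a))"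
      unfolding sum_negf[symmetric] by (intro sum.cong refl, subst force_swap) simp
    finally have "(\<Sum>i<n. \<Sum>j<n. k i * k j * (force (u j - u i) * (\<delta> i - \<delta> j)))
      = (\<Sum>j<n. k a * k j * force (u j - u a)) + (\<Sum>i<n. k a * k i * force (u i - u a))"
      by (simp only: d diff_minus_eq_add)
    then show ?thesis by (simp add: sum_distrib_left mult.assoc)
  qed
  ultimately show ?thesis by simp
qed

lemma energy_nonneg: "(\<And>i. i < n \<Longrightarrow> 0 \<le> k i) \<Longrightarrow> 0 \<le> energy n k u"
  unfolding energy_def by (intro sum_nonneg mult_nonneg_nonneg potential_nonneg) auto

text \<open>All terms are nonnegative and all weights at least 1. On spread configurations a bound
  on the energy thus keeps the gaps away from 0 and 2 pi.\<close>

lemma potential_le_energy: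
  assumes k: "\<And>i. i < n \<Longrightarrow> 1 \<le> k i" and ij: "i < n" "j < n"
  shows "potential (u j - u i) \<le> energy n k u"
proof -
  have nn: "0 \<le> k i * k j * potential (u j - u i)" if "i < n" "j < n" for i j
    using k[OF that(1)] k[OF that(2)] by (intro mult_nonneg_nonneg potential_nonneg) auto
  have "1 * 1 \<le> k i * k j" using k[OF ij(1)] k[OF ij(2)] by (intro mult_mono) auto
  then have "potential (u j - u i) \<le> k i * k j * potential (u j - u i)"
    using mult_right_mono[OF _ potential_nonneg] by fastforce
  also have "\<dots> \<le> (\<Sum>j<n. k i * k j * potential (u j - u i))"
    using ij nn by (intro member_le_sum[where f = "\<lambda>j. k i * k j * potential (u j - u i)"]) auto
  also have "\<dots> \<le> energy n k u"
    unfolding energy_def using ij nn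
    by (intro member_le_sum[where f = "\<lambda>i. \<Sum>j<n. k i * k j * potential (u j - u i)"]) (auto intro!: sum_nonneg)
  finally show ?thesis .
qed

text \<open>Internal forces cancel in pairs. This yields the equation of a particle held fixed once
  the others are in equilibrium.\<close>

lemma sum_forces: "(\<Sum>i<n. k i * (\<Sum>j<n. k j * force (u j - u i))) = 0"
proof -
  let ?S = "\<Sum>i<n. \<Sum>j<n. k i * k j * force (u j - u i)"
  have "?S = (\<Sum>i<n. \<Sum>j<n. k i * k j * force (u i - u j))"
    by (subst sum.swap) (simp add: ac_simps)
  also have "\<dots> = - ?S"
    unfolding sum_negf[symmetric] by (intro sum.cong refl, subst force_swap) simp
  finally show ?thesis by (simp add: sum_distrib_left ac_simps)
qed

text \<open>A closed subset of a product of compact intervals, compact by Tychonoff. Coordinates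
  from \<open>n\<close> on are confined as well, so that the product over all indices is compact;
  \<open>u 0 = 0\<close> removes the freedom of translation.\<close>

lemma compact_separated:
  "compact {u :: nat \<Rightarrow> real. (\<forall>i. 0 \<le> u i \<and> u i \<le> 2 * pi) \<and> u 0 = 0 \<and>
     (\<forall>i j. i < j \<and> j < n \<longrightarrow> e \<le> u j - u i \<and> u j - u i \<le> 2 * pi - e)}"
proof -
  have "compact (PiE UNIV (\<lambda>_ :: nat. {0..2 * pi}))"
    using compactin_PiE[of "\<lambda>_ :: nat. euclideanreal" UNIV "\<lambda>_. {0..2 * pi}"]
    by (simp add: euclidean_product_topology)
  moreover have "closed {u :: nat \<Rightarrow> real. u 0 = 0 \<and>
     (\<forall>i j. i < j \<and> j < n \<longrightarrow> e \<le> u j - u i \<and> u j - u i \<le> 2 * pi - e)}"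
    by (intro closed_Collect_conj closed_Collect_all closed_Collect_imp closed_Collect_eq
        closed_Collect_le continuous_intros open_Collect_const continuous_on_product_coordinates)
  ultimately have "compact (PiE UNIV (\<lambda>_ :: nat. {0..2 * pi}) \<inter> {u :: nat \<Rightarrow> real. u 0 = 0 \<and>
     (\<forall>i j. i < j \<and> j < n \<longrightarrow> e \<le> u j - u i \<and> u j - u i \<le> 2 * pi - e)})"
    by (rule compact_Int_closed)
  then show ?thesis by (rule back_subst[of compact]) (auto simp: PiE_def Pi_def)
qed

text \<open>The energy attains its minimum on the compact set \<open>K\<close> of configurations
  whose gaps stay \<open>e\<close> away from 0 and 2 pi. For small \<open>e\<close> no gap bound is
  attained at the minimizer, so the energy is stationary there in every coordinate but the pinned
  one.\<close>

lemma balanced_exists: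
  assumes n: "0 < n" and k: "\<And>i. i < n \<Longrightarrow> 1 \<le> k i"
  obtains u where "u 0 = 0" "spread n u" "balanced n k u"
proof -
  \<comment> \<open>A reference configuration whose energy \<open>C\<close> bounds the minimum; its
    span is below 1, far from 2 pi.\<close>
  define p where "p i = (if i < n then real i / real n else 0)" for i
  define C where "C = energy n k p"
  \<comment> \<open>The first bound gives \<open>e * C < 1\<close> and hence
    \<open>C < potential e\<close>, with \<open>C + 1\<close> covering \<open>C = 0\<close>; the
    second puts \<open>p\<close> into \<open>K\<close>.\<close>
  define e where "e = min (1 / (C + 1)) (1 / real n)"
  have C: "0 \<le> C" unfolding C_def using k by (intro energy_nonneg) force
  have e: "0 < e" "e \<le> 1" "e * C < 1" "e \<le> 1 / real n"
  proof -
    show "0 < e" "e \<le> 1 / real n" using C n by (auto simp: e_def)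
    show "e \<le> 1" using C unfolding e_def by (intro min.coboundedI1) (simp add: divide_simps)
    have "e * C \<le> 1 / (C + 1) * C" using C by (intro mult_right_mono) (auto simp: e_def)
    also have "\<dots> < 1" using C by (simp add: divide_simps)
    finally show "e * C < 1" .
  qed
  define K where "K = {u :: nat \<Rightarrow> real. (\<forall>i. 0 \<le> u i \<and> u i \<le> 2 * pi) \<and> u 0 = 0 \<and>
     (\<forall>i j. i < j \<and> j < n \<longrightarrow> e \<le> u j - u i \<and> u j - u i \<le> 2 * pi - e)}"
  have Kspread: "spread n u" if "u \<in> K" for u
    using that e unfolding K_def spread_def by fastforce
  have "p \<in> K"
  proof -
    have "0 \<le> p i \<and> p i \<le> 2 * pi" for i
      using pi_gt3 n by (auto simp: p_def divide_simps)
        (smt (verit) mult_le_cancel_right1 of_nat_0_le_iff of_nat_less_iff)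
    moreover have "e \<le> p j - p i \<and> p j - p i \<le> 2 * pi - e" if "i < j" "j < n" for i j
    proof -
      have "p j - p i = (real j - real i) / real n"
        using that by (simp add: p_def diff_divide_distrib)
      moreover have "1 / real n \<le> (real j - real i) / real n" "(real j - real i) / real n \<le> 1"
        using that by (auto intro!: divide_right_mono simp: divide_simps)
      ultimately show ?thesis using e pi_gt3 by auto
    qed
    ultimately show ?thesis by (auto simp: K_def p_def)
  qed
  have "continuous_on K (energy n k)"
  proof -
    have "continuous_on K (\<lambda>u. potential (u j - u i))" if "i < n" "j < n" for i j
    proof (cases "i = j")
      case False
      have "sin ((u j - u i) / 2) \<noteq> 0" if "u \<in> K" for u
        using sin_half_nonzero[OF Kspread[OF that] \<open>i < n\<close> \<open>j < n\<close> False] .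
      then show ?thesis unfolding potential_def
        by (intro continuous_intros continuous_on_subset[OF continuous_on_product_coordinates]) auto
    qed simp
    then show ?thesis unfolding energy_def by (intro continuous_intros) auto
  qed
  moreover have "compact K" unfolding K_def by (rule compact_separated)
  ultimately obtain u where u: "u \<in> K" "\<And>v. v \<in> K \<Longrightarrow> energy n k u \<le> energy n k v"
    using continuous_attains_inf[of K "energy n k"] \<open>p \<in> K\<close> by blast
  have sp: "spread n u" using Kspread u(1) .
  \<comment> \<open>A gap equal to \<open>e\<close> or \<open>2 * pi - e\<close> would alone cost
    more than \<open>C\<close>, the energy of \<open>p\<close>.\<close>
  have strict: "e < u j - u i \<and> u j - u i < 2 * pi - e" if ij: "i < j" "j < n" for i j
  proof -
    have "C < potential e"
    proof -
      have s: "0 < sin (e / 2)" "sin (e / 2) \<le> e / 2"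
        using e pi_gt3 sin_x_le_x[of "e / 2"] sin_half_pos[of e] by auto
      have "C * sin (e / 2) ^ 2 \<le> C * e ^ 2"
        using s e C by (intro mult_left_mono power_mono) auto
      also have "\<dots> = (e * C) * e" by (simp add: power2_eq_square)
      also have "\<dots> \<le> e * C * 1" using e C by (intro mult_left_mono) auto
      also have "\<dots> < 1" using e by simp
      finally show ?thesis using s by (simp add: potential_def divide_simps)
    qed
    moreover have "potential (u j - u i) \<le> C"
      using potential_le_energy[of n k i j u] k ij u(2)[OF \<open>p \<in> K\<close>] by (simp add: C_def)
    moreover have "potential (2 * pi - e) = potential e"
      by (simp add: potential_def diff_divide_distrib)
    moreover have "e \<le> u j - u i \<and> u j - u i \<le> 2 * pi - e"
      using u(1) ij by (auto simp: K_def)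
    ultimately show ?thesis by (cases "u j - u i = e"; cases "u j - u i = 2 * pi - e") auto
  qed
  have crit: "(\<Sum>j<n. k j * force (u j - u a)) = 0" if a: "a < n" "a \<noteq> 0" for a
  proof -
    have cont: "((\<lambda>h. (u(a := u a + h)) i) \<longlongrightarrow> u i) (nhds 0)" for i
    proof (cases "i = a")
      case True
      have "((\<lambda>h. u a + h) \<longlongrightarrow> u a + 0) (nhds 0)" by (intro tendsto_intros) (simp add: filterlim_ident)
      then show ?thesis using True by simp
    qed simp
    have range: "0 < u a" "u a < 2 * pi"
      using strict[of 0 a] a u(1) e by (auto simp: K_def)
    \<comment> \<open>Strict bounds on finitely many pairs survive small moves of particle
      \<open>a\<close>, so the minimum over \<open>K\<close> is a local minimum in this
      coordinate.\<close>
    have "\<forall>\<^sub>F h in nhds 0. u(a := u a + h) \<in> K"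
    proof -
      have "\<forall>\<^sub>F h in nhds 0. \<forall>j\<in>{..<n}. \<forall>i\<in>{..<j}.
          e < (u(a := u a + h)) j - (u(a := u a + h)) i \<and>
          (u(a := u a + h)) j - (u(a := u a + h)) i < 2 * pi - e"
        using strict
        by (intro eventually_ball_finite ballI finite_lessThan eventually_conj
            order_tendstoD[OF tendsto_diff[OF cont cont]]) auto
      moreover have "\<forall>\<^sub>F h in nhds 0. 0 < (u(a := u a + h)) a \<and> (u(a := u a + h)) a < 2 * pi"
        using range by (intro eventually_conj order_tendstoD[OF cont]) auto
      ultimately show ?thesis
      proof eventually_elim
        case (elim h)
        have "0 \<le> (u(a := u a + h)) i \<and> (u(a := u a + h)) i \<le> 2 * pi" for i
          using elim(2) u(1) by (cases "i = a") (auto simp: K_def)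
        moreover have "(u(a := u a + h)) 0 = 0" using a u(1) by (simp add: K_def)
        moreover have "e \<le> (u(a := u a + h)) j - (u(a := u a + h)) i \<and>
            (u(a := u a + h)) j - (u(a := u a + h)) i \<le> 2 * pi - e" if "i < j" "j < n" for i j
          using bspec[OF bspec[OF elim(1), of j], of i] that by (auto simp del: fun_upd_apply)
        ultimately show ?case unfolding K_def by blast
      qed
    qed
    then obtain d where d: "0 < d" "\<And>h. \<bar>h\<bar> < d \<Longrightarrow> u(a := u a + h) \<in> K"
      by (auto simp: eventually_nhds_metric dist_real_def)
    have "2 * k a * (\<Sum>j<n. k j * force (u j - u a)) = 0"
      by (rule DERIV_local_min[OF has_real_derivative_energy[OF sp a(1)] d(1)])
        (use d(2) u(2) in auto)
    then show ?thesis using k[OF a(1)] by auto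
  qed
  have "balanced n k u" unfolding balanced_def
  proof (intro allI impI)
    fix i assume "i < n"
    show "(\<Sum>j<n. k j * force (u j - u i)) = 0"
    proof (cases "i = 0")
      case True
      \<comment> \<open>Only the pinned particle can contribute to the total, which is zero.\<close>
      have "(\<Sum>i<n. k i * (\<Sum>j<n. k j * force (u j - u i))) = k 0 * (\<Sum>j<n. k j * force (u j - u 0))"
        using n crit by (subst sum.remove[of _ 0]) auto
      then show ?thesis using sum_forces[where n = n and k = k and u = u] k[OF n] True by auto
    qed (use crit \<open>i < n\<close> in auto)
  qed
  then show ?thesis using that sp u(1) by (auto simp: K_def)
qed

subsection \<open>Real arrangements as families of mirrors\<close>

definition normal_vec :: "real \<Rightarrow> complex^2" where
  "normal_vec t = vector [complex_of_real (cos (t / 2)), complex_of_real (sin (t / 2))]"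

definition direction :: "real \<Rightarrow> complex^2" where
  "direction t = vector [- complex_of_real (sin (t / 2)), complex_of_real (cos (t / 2))]"

definition mirror :: "real \<Rightarrow> (complex^2) set" where
  "mirror t = {x. scalar_product (normal_vec t) x = 0}"

lemma normal_vec_nth [simp]:
  "normal_vec t $ 1 = complex_of_real (cos (t / 2))" "normal_vec t $ 2 = complex_of_real (sin (t / 2))"
  by (simp_all add: normal_vec_def)

lemma direction_nth [simp]:
  "direction t $ 1 = - complex_of_real (sin (t / 2))" "direction t $ 2 = complex_of_real (cos (t / 2))"
  by (simp_all add: direction_def)

lemma scalar_product_normal_vec:
  "scalar_product (normal_vec s) (normal_vec t) = complex_of_real (cos ((s - t) / 2))"
  by (simp add: scalar_product_2 diff_divide_distrib cos_diff)

lemma scalar_product_normal_vec_direction: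
  "scalar_product (normal_vec s) (c *s direction t) = c * complex_of_real (sin ((s - t) / 2))"
  by (simp add: scalar_product_2 diff_divide_distrib sin_diff algebra_simps)

lemma cos_sin_squared_of_real:
  "complex_of_real (cos t) * complex_of_real (cos t) + complex_of_real (sin t) * complex_of_real (sin t) = 1"
  by (metis of_real_1 of_real_add of_real_mult power2_eq_square sin_cos_squared_add2)

lemma is_normal_mirror: "is_normal (normal_vec t) (mirror t)"
proof -
  have "normal_vec t \<noteq> 0" using scalar_product_normal_vec[of t t] by (auto simp: scalar_product_def)
  then show ?thesis by (simp add: is_normal_def mirror_def)
qed

lemma mem_mirrorE:
  assumes "x \<in> mirror t"
  obtains c where "x = c *s direction t"
proof
  let ?c = "complex_of_real (cos (t / 2))" and ?s = "complex_of_real (sin (t / 2))"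
  have e: "?c * x $ 1 = - ?s * x $ 2"
    using assms by (simp add: mirror_def scalar_product_2 eq_neg_iff_add_eq_0)
  have p: "?c * ?c + ?s * ?s = 1" by (rule cos_sin_squared_of_real)
  \<comment> \<open>The coefficient is the bilinear product of \<open>direction t\<close> and
    \<open>x\<close>.\<close>
  have "x $ 1 = (?c * x $ 2 - ?s * x $ 1) * - ?s" using e p by algebra
  moreover have "x $ 2 = (?c * x $ 2 - ?s * x $ 1) * ?c" using e p by algebra
  ultimately show "x = (?c * x $ 2 - ?s * x $ 1) *s direction t"
    unfolding vec_eq_iff forall_2 vector_smult_component direction_nth by blast
qed

lemma direction_mem_mirror: "direction t \<in> mirror t"
  by (simp add: mirror_def scalar_product_2)

lemma line_angle_mirror:
  assumes "0 \<le> t" "t < 2 * pi"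
  shows "line_angle (mirror t) = t"
  unfolding line_angle_def
proof (rule the1_equality)
  have "\<forall>i. normal_vec t $ i \<in> \<real>" by (simp add: forall_2)
  then show "\<exists>!\<theta>. is_line_angle (mirror t) \<theta>" using line_angle_ex1 is_normal_mirror by blast
  have "normal_vec t = 1 *s vector [complex_of_real (cos (t / 2)), complex_of_real (sin (t / 2))]"
    by (simp add: normal_vec_def)
  then show "is_line_angle (mirror t) t"
    using assms is_normal_mirror unfolding is_line_angle_def by blast
qed

lemma mirror_line_angle:
  assumes "is_normal a H" "\<forall>i. a $ i \<in> \<real>"
  shows "mirror (line_angle H) = H" "0 \<le> line_angle H" "line_angle H < 2 * pi"
proof -
  have "is_line_angle H (line_angle H)"
    unfolding line_angle_def by (rule theI'[OF line_angle_ex1[OF assms]])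
  then obtain b c where b: "0 \<le> line_angle H" "line_angle H < 2 * pi" "is_normal b H"
      "b = c *s normal_vec (line_angle H)"
    unfolding is_line_angle_def normal_vec_def by blast
  then have "c \<noteq> 0" "H = {x. scalar_product b x = 0}" by (auto simp: is_normal_def)
  moreover have "scalar_product b x = c * scalar_product (normal_vec (line_angle H)) x" for x
    by (simp add: b(4) scalar_product_2 algebra_simps)
  ultimately show "mirror (line_angle H) = H" by (simp add: mirror_def)
  show "0 \<le> line_angle H" "line_angle H < 2 * pi" by fact+
qed

text \<open>The half-angle grows by pi, which negates the normal. Representatives outside [0, 2 pi)
  therefore give the same lines.\<close>

lemma mirror_add_2pi: "mirror (t + 2 * pi) = mirror t"
proof -
  have "(t + 2 * pi) / 2 = t / 2 + pi" by simp
  then have "normal_vec (t + 2 * pi) = - normal_vec t"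
    by (simp only: vec_eq_iff forall_2 normal_vec_nth vector_uminus_component) simp
  then show ?thesis unfolding mirror_def by (auto simp: scalar_product_2 add_eq_0_iff)
qed

text \<open>The product of \<open>normal_vec (u j)\<close> and \<open>direction (u i)\<close> is
  \<open>sin ((u j - u i) / 2)\<close>. Hence \<open>direction (u i)\<close> is an admissible test
  point on its line.\<close>

lemma direction_mem_mirror_iff:
  assumes "spread n u" "i < n" "j < n"
  shows "direction (u i) \<in> mirror (u j) \<longleftrightarrow> i = j"
  using sin_half_nonzero[OF assms] scalar_product_normal_vec_direction[of "u j" 1 "u i"]
    direction_mem_mirror
  by (auto simp: mirror_def)

lemma inj_on_mirror:
  assumes "spread n u"
  shows "inj_on (\<lambda>i. mirror (u i)) {..<n}"
  by (rule inj_onI) (metis assms direction_mem_mirror_iff direction_mem_mirror lessThan_iff)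

lemma real_arrangement_mirrors:
  fixes n :: nat
  assumes "lines_of A = (\<lambda>i. mirror (u i)) ` {..<n}"
  shows "real_arrangement A" "arrangement A"
proof -
  have r: "\<forall>i. normal_vec t $ i \<in> \<real>" for t by (simp add: forall_2)
  have n: "scalar_product (normal_vec t) (normal_vec t) \<noteq> 0" for t
    by (simp add: scalar_product_normal_vec)
  show "arrangement A"
    unfolding arrangement_def assms using is_normal_mirror n by auto
  then show "real_arrangement A"
    unfolding real_arrangement_def assms using is_normal_mirror r by blast
qed

section \<open>The first-locus condition as a balance of forces\<close>

text \<open>At the point \<open>c *s direction (u i)\<close> of line \<open>i\<close>, the term of
  line \<open>j\<close> is \<open>k j * force (u j - u i) / c ^ 3\<close>, so the condition along
  the whole line reduces to one real equation.\<close>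

lemma first_locus_iff_balanced:
  assumes u: "spread n u" and A: "lines_of A = (\<lambda>i. mirror (u i)) ` {..<n}"
    and k: "\<And>i. i < n \<Longrightarrow> k i = real (A (mirror (u i)) * (A (mirror (u i)) + 1))"
  shows "first_locus_configuration A \<longleftrightarrow> balanced n k u"
proof -
  note inj = inj_on_mirror[OF u]
  \<comment> \<open>Normals of bilinear length 1; testing this single choice suffices.\<close>
  define \<alpha> where "\<alpha> H = normal_vec (u (inv_into {..<n} (\<lambda>i. mirror (u i)) H))" for H
  have \<alpha>: "\<alpha> (mirror (u i)) = normal_vec (u i)" if "i < n" for i
    using inv_into_f_f[OF inj] that by (simp add: \<alpha>_def)
  have "normal_choice A \<alpha>"
    unfolding normal_choice_def A using \<alpha> is_normal_mirror by auto
  then have "first_locus_configuration A \<longleftrightarrow> first_locus_wrt A \<alpha>"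
    using first_locus_configuration_iff real_arrangement_mirrors(2)[OF A] by blast
  also have "\<dots> \<longleftrightarrow> balanced n k u"
  proof -
    let ?t = "\<lambda>i x K. of_nat (A K * (A K + 1)) * scalar_product (\<alpha> K) (\<alpha> K)
      * scalar_product (\<alpha> K) (\<alpha> (mirror (u i))) / scalar_product (\<alpha> K) x ^ 3"
    \<comment> \<open>For \<open>c = 0\<close> both sides vanish by the convention
      \<open>x / 0 = 0\<close>.\<close>
    have sum_eq: "(\<Sum>K\<in>lines_of A - {mirror (u i)}. ?t i (c *s direction (u i)) K)
        = complex_of_real (\<Sum>j<n. k j * force (u j - u i)) / c ^ 3" if i: "i < n" for i c
    proof -
      have "lines_of A - {mirror (u i)} = (\<lambda>i. mirror (u i)) ` ({..<n} - {i})"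
        unfolding A using inj_on_image_set_diff[OF inj, of "{..<n}" "{i}"] i by simp
      then have "(\<Sum>K\<in>lines_of A - {mirror (u i)}. ?t i (c *s direction (u i)) K)
        = (\<Sum>j\<in>{..<n} - {i}. ?t i (c *s direction (u i)) (mirror (u j)))"
        using inj by (simp only: sum.reindex[OF inj_on_subset[OF inj]] Diff_subset) simp
      also have "\<dots> = (\<Sum>j\<in>{..<n} - {i}. complex_of_real (k j * force (u j - u i)) / c ^ 3)"
        using i
        by (intro sum.cong refl)
          (simp add: \<alpha> k scalar_product_normal_vec scalar_product_normal_vec_direction force_def
            power_mult_distrib)
      \<comment> \<open>The term \<open>j = i\<close> may be added because
        \<open>force 0 = 0\<close>.\<close>
      also have "\<dots> = (\<Sum>j<n. complex_of_real (k j * force (u j - u i)) / c ^ 3)"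
        using i by (intro sum.mono_neutral_left) auto
      finally show ?thesis by (simp add: sum_divide_distrib)
    qed
    show ?thesis
    proof
      assume f: "first_locus_wrt A \<alpha>"
      show "balanced n k u" unfolding balanced_def
      proof (intro allI impI)
        fix i assume i: "i < n"
        have "\<forall>K\<in>lines_of A - {mirror (u i)}. direction (u i) \<notin> K"
          unfolding A using direction_mem_mirror_iff[OF u i] by auto
        then have "(\<Sum>K\<in>lines_of A - {mirror (u i)}. ?t i (direction (u i)) K) = 0"
          using f[unfolded first_locus_wrt_def, rule_format, OF _ direction_mem_mirror] i A by blast
        then have "complex_of_real (\<Sum>j<n. k j * force (u j - u i)) = 0"
          using sum_eq[OF i, of 1] by simp
        then show "(\<Sum>j<n. k j * force (u j - u i)) = 0" using of_real_eq_0_iff by blast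
      qed
    next
      assume b: "balanced n k u"
      show "first_locus_wrt A \<alpha>" unfolding first_locus_wrt_def
      proof (intro ballI impI)
        fix H x assume "H \<in> lines_of A" "x \<in> H"
        then obtain i where i: "i < n" "H = mirror (u i)" "x \<in> mirror (u i)" unfolding A by auto
        obtain c where "x = c *s direction (u i)" using mem_mirrorE[OF i(3)] .
        then show "(\<Sum>K\<in>lines_of A - {H}. of_nat (A K * (A K + 1)) * scalar_product (\<alpha> K) (\<alpha> K)
            * scalar_product (\<alpha> K) (\<alpha> H) / scalar_product (\<alpha> K) x ^ 3) = 0"
          using sum_eq[OF i(1), of c] b i by (simp only: balanced_def) simp
      qed
    qed
  qed
  finally show ?thesis .
qed

section \<open>Cyclic lists of multiplicities and increasing angles\<close>

text \<open>Raising the angles after the wrap-around by \<open>2\<pi>\<close> makes a cyclically ordered list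
  increasing, within an interval shorter than \<open>2\<pi>\<close>.\<close>

lemma mirrors_of_cyclic_multiplicities:
  assumes A: "real_arrangement A" and m: "has_cyclic_multiplicities A m"
  obtains u where "spread (length m) u" "lines_of A = (\<lambda>i. mirror (u i)) ` {..<length m}"
    "\<And>i. i < length m \<Longrightarrow> A (mirror (u i)) = m ! i"
proof -
  obtain Hs l where Hs: "set Hs = lines_of A" "map A Hs = m"
    and l: "sorted_wrt (<) (rotate l (map line_angle Hs))"
    using m unfolding has_cyclic_multiplicities_def cyclically_ordered_def by blast
  define ts where "ts = map line_angle Hs"
  \<comment> \<open>The wrap-around index: entries before \<open>r\<close> are the larger angles. If
    \<open>r\<close> is 0, all angles are raised by 2 pi, which changes no gap.\<close>
  define r where "r = l mod length ts"
  have len: "length ts = length m" "length Hs = length m" using Hs(2) by (auto simp: ts_def)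
  define u where "u i = ts ! i + (if i < r then 0 else 2 * pi)" for i
  have H: "mirror (ts ! i) = Hs ! i" "0 \<le> ts ! i" "ts ! i < 2 * pi" if "i < length m" for i
  proof -
    have "Hs ! i \<in> lines_of A" using that Hs len by (metis nth_mem)
    then obtain a where "is_normal a (Hs ! i)" "\<forall>j. a $ j \<in> \<real>"
      using A unfolding real_arrangement_def by blast
    from mirror_line_angle[OF this] show "mirror (ts ! i) = Hs ! i" "0 \<le> ts ! i" "ts ! i < 2 * pi"
      using that len by (auto simp: ts_def)
  qed
  have u: "mirror (u i) = Hs ! i" if "i < length m" for i
    using H[OF that] by (simp add: u_def mirror_add_2pi)
  have "sorted_wrt (<) (drop r ts @ take r ts)"
    using l unfolding ts_def[symmetric] rotate_drop_take r_def .
  then have s: "sorted_wrt (<) (drop r ts)" "sorted_wrt (<) (take r ts)"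
    "\<And>x y. x \<in> set (drop r ts) \<Longrightarrow> y \<in> set (take r ts) \<Longrightarrow> x < y"
    by (auto simp: sorted_wrt_append)
  have "spread (length m) u" unfolding spread_def
  proof (intro allI impI)
    fix i j assume ij: "i < j" "j < length m"
    \<comment> \<open>On one side of the wrap-around the gap is unchanged; across it, it becomes
      \<open>2 * pi - (ts ! i - ts ! j)\<close>.\<close>
    consider "j < r" | "r \<le> i" | "i < r" "r \<le> j" by linarith
    then show "0 < u j - u i \<and> u j - u i < 2 * pi"
    proof cases
      case 1
      then have "ts ! i < ts ! j" using sorted_wrt_nth_less[OF s(2) ij(1)] ij len by simp
      then show ?thesis using H(2)[of i] H(3)[of j] ij 1 by (simp add: u_def)
    next
      case 2
      then have "ts ! i < ts ! j"
        using sorted_wrt_nth_less[OF s(1), of "i - r" "j - r"] ij len by simp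
      then show ?thesis using H(2)[of i] H(3)[of j] ij 2 by (simp add: u_def)
    next
      case 3
      have "ts ! j \<in> set (drop r ts)" using ij len 3 by (auto simp: in_set_conv_nth intro!: exI[of _ "j - r"])
      moreover have "ts ! i \<in> set (take r ts)" using ij len 3 by (auto simp: in_set_conv_nth)
      ultimately have "ts ! j < ts ! i" by (rule s(3))
      then show ?thesis using H(2)[of j] H(3)[of i] ij 3 by (simp add: u_def)
    qed
  qed
  moreover have "lines_of A = (\<lambda>i. mirror (u i)) ` {..<length m}"
    unfolding Hs(1)[symmetric] using u by (auto simp: set_conv_nth len image_def)
  moreover have "A (mirror (u i)) = m ! i" if "i < length m" for i
    using u[OF that] that Hs(2) len by (metis nth_map)
  ultimately show thesis using that by blast
qed

lemma has_cyclic_multiplicities_mirrors: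
  assumes u: "spread (length m) u" "\<And>i. i < length m \<Longrightarrow> 0 \<le> u i \<and> u i < 2 * pi"
    and A: "lines_of A = (\<lambda>i. mirror (u i)) ` {..<length m}"
    "\<And>i. i < length m \<Longrightarrow> A (mirror (u i)) = m ! i"
  shows "has_cyclic_multiplicities A m"
proof -
  define Hs where "Hs = map (\<lambda>i. mirror (u i)) [0..<length m]"
  have "distinct Hs"
    using inj_on_mirror[OF u(1)] by (simp add: Hs_def distinct_map lessThan_atLeast0)
  moreover have "set Hs = lines_of A" by (simp add: Hs_def A lessThan_atLeast0)
  moreover have "map A Hs = m" by (rule nth_equalityI) (auto simp: Hs_def A)
  moreover have "sorted_wrt (<) (rotate 0 (map line_angle Hs))"
    using spreadD[OF u(1)] line_angle_mirror u(2)
    by (auto simp: Hs_def sorted_wrt_iff_nth_less)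
  ultimately show ?thesis
    unfolding has_cyclic_multiplicities_def cyclically_ordered_def by blast
qed

section \<open>Rotations acting on mirrors\<close>

text \<open>The plane is turned by \<open>c / 2\<close>, because the line of angle \<open>t\<close>
  has its normal at \<open>t / 2\<close>; line angles are thus shifted by \<open>c\<close>.\<close>

definition rotation :: "real \<Rightarrow> real^2^2" where
  "rotation c = vector [vector [cos (c / 2), - sin (c / 2)], vector [sin (c / 2), cos (c / 2)]]"

abbreviation rotate_vec :: "real \<Rightarrow> complex^2 \<Rightarrow> complex^2" where
  "rotate_vec c x \<equiv> map_matrix complex_of_real (rotation c) *v x"

lemma rotation_matrix_rotation: "rotation_matrix (rotation c)"
proof -
  have "cos (c / 2) * cos (c / 2) + sin (c / 2) * sin (c / 2) = 1"
    using sin_cos_squared_add2[of "c / 2"] by (simp add: power2_eq_square)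
  then show ?thesis
    by (simp add: rotation_matrix_def orthogonal_matrix rotation_def det_2 vec_eq_iff forall_2
        matrix_matrix_mult_def transpose_def mat_def sum_2 mult.commute add.commute)
qed

lemma rotate_vec_nth:
  "rotate_vec c x $ 1 = complex_of_real (cos (c / 2)) * x $ 1 - complex_of_real (sin (c / 2)) * x $ 2"
  "rotate_vec c x $ 2 = complex_of_real (sin (c / 2)) * x $ 1 + complex_of_real (cos (c / 2)) * x $ 2"
  by (simp_all add: matrix_vector_mult_def map_matrix_def rotation_def sum_2)

lemma rotate_vec_minus: "rotate_vec (- c) (rotate_vec c x) = x"
proof -
  let ?c = "complex_of_real (cos (c / 2))" and ?s = "complex_of_real (sin (c / 2))"
  have "?c * ?c + ?s * ?s = 1" by (rule cos_sin_squared_of_real)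
  then have "?c * (?c * x $ 1 - ?s * x $ 2) + ?s * (?s * x $ 1 + ?c * x $ 2) = x $ 1"
    "- ?s * (?c * x $ 1 - ?s * x $ 2) + ?c * (?s * x $ 1 + ?c * x $ 2) = x $ 2"
    by algebra+
  then show ?thesis by (simp add: vec_eq_iff forall_2 rotate_vec_nth)
qed

lemma rotate_vec_mem_mirror: "x \<in> mirror t \<Longrightarrow> rotate_vec c x \<in> mirror (t + c)"
proof (elim mem_mirrorE)
  fix d assume "x = d *s direction t"
  then have "rotate_vec c x = d *s direction (t + c)"
    by (simp add: vec_eq_iff forall_2 rotate_vec_nth add_divide_distrib cos_add sin_add algebra_simps)
  then show ?thesis using scalar_product_normal_vec_direction[of "t + c" d "t + c"] by (simp add: mirror_def)
qed

lemma rotate_vec_image_mirror: "rotate_vec c ` mirror t = mirror (t + c)"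
proof (intro equalityI subsetI)
  fix y assume "y \<in> mirror (t + c)"
  then have "rotate_vec (- c) y \<in> mirror t" using rotate_vec_mem_mirror[of y "t + c" "- c"] by simp
  moreover have "y = rotate_vec c (rotate_vec (- c) y)" using rotate_vec_minus[of "- c" y] by simp
  ultimately show "y \<in> rotate_vec c ` mirror t" by blast
qed (auto intro: rotate_vec_mem_mirror)

lemma rotation_related_mirrors:
  assumes A: "lines_of A = (\<lambda>i. mirror (u i)) ` {..<n}"
    and B: "lines_of B = (\<lambda>i. mirror (u i + c)) ` {..<n}"
    and AB: "\<And>i. i < n \<Longrightarrow> B (mirror (u i + c)) = A (mirror (u i))"
  shows "rotation_related A B"
  unfolding rotation_related_def
proof (intro exI conjI allI)
  show "rotation_matrix (rotation c)" by (rule rotation_matrix_rotation)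
  fix H
  show "B (rotate_vec c ` H) = A H"
  proof (cases "H \<in> lines_of A")
    case True
    then show ?thesis using A AB by (auto simp: rotate_vec_image_mirror)
  next
    case False
    \<comment> \<open>Multiplicities must agree at every set: by injectivity a set outside
      \<open>lines_of A\<close> is not carried to a line of \<open>B\<close>, so both values are
      0.\<close>
    have "inj (rotate_vec c)" by (metis injI rotate_vec_minus)
    then have "rotate_vec c ` H \<notin> lines_of B"
      using False unfolding A B by (auto simp flip: rotate_vec_image_mirror simp: inj_image_eq_iff)
    then show ?thesis using False by (simp add: lines_of_def)
  qed
qed

section \<open>Existence and uniqueness up to rotation\<close>

theorem corollary5p2:
  fixes m :: "nat list"
  assumes "\<forall>k\<in>set m. 0 < k"
  shows "(\<exists>A. real_arrangement A \<and> first_locus_configuration A \<and> has_cyclic_multiplicities A m) \<and>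
         (\<forall>A B. real_arrangement A \<and> first_locus_configuration A \<and> has_cyclic_multiplicities A m \<longrightarrow>
                real_arrangement B \<and> first_locus_configuration B \<and> has_cyclic_multiplicities B m \<longrightarrow>
                rotation_related A B)"
proof -
  define n where "n = length m"
  define k where "k i = real (m ! i * (m ! i + 1))" for i
  have mpos: "0 < m ! i" if "i < n" for i using assms that by (simp add: n_def)
  have k1: "1 \<le> k i" if "i < n" for i
  proof -
    have "1 \<le> m ! i * (m ! i + 1)" using mpos[OF that] by simp
    then show ?thesis unfolding k_def by (metis of_nat_1 of_nat_le_iff)
  qed
  have "\<exists>A. real_arrangement A \<and> first_locus_configuration A \<and> has_cyclic_multiplicities A m"
  proof -
    \<comment> \<open>With \<open>u 0 = 0\<close> a spread configuration lies in [0, 2 pi), so the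
      angles are the line angles themselves. The empty list gives the empty arrangement.\<close>
    obtain u where u: "spread n u" "balanced n k u" "\<And>i. i < n \<Longrightarrow> 0 \<le> u i \<and> u i < 2 * pi"
    proof (cases "n = 0")
      case True
      then show thesis using that[of "\<lambda>_. 0"] by (simp add: spread_def balanced_def)
    next
      case False
      then obtain u where u: "u 0 = 0" "spread n u" "balanced n k u"
        using balanced_exists[of n k] k1 by blast
      have "0 \<le> u i \<and> u i < 2 * pi" if "i < n" for i
        using spreadD[OF u(2), of 0 i] u(1) that by (cases "i = 0") auto
      with u show thesis using that by blast
    qed
    \<comment> \<open>Multiplicities are read off through the inverse of the injective map from
      indices to mirrors; as the entries of \<open>m\<close> are positive, exactly the mirrors
      become lines.\<close>
    define A where "A H = (if H \<in> (\<lambda>i. mirror (u i)) ` {..<n}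
        then m ! inv_into {..<n} (\<lambda>i. mirror (u i)) H else 0)" for H
    have Am: "A (mirror (u i)) = m ! i" if "i < n" for i
      using inv_into_f_f[OF inj_on_mirror[OF u(1)]] that by (simp add: A_def)
    have L: "lines_of A = (\<lambda>i. mirror (u i)) ` {..<n}"
    proof (intro equalityI subsetI)
      fix H assume "H \<in> lines_of A"
      then show "H \<in> (\<lambda>i. mirror (u i)) ` {..<n}" by (auto simp: lines_of_def A_def split: if_splits)
    qed (use Am mpos in \<open>force simp: lines_of_def\<close>)
    have "first_locus_configuration A \<longleftrightarrow> balanced n k u"
      by (rule first_locus_iff_balanced[OF u(1) L]) (simp add: k_def Am)
    then have "first_locus_configuration A" using u(2) by blast
    moreover have "has_cyclic_multiplicities A m"
      using u L Am has_cyclic_multiplicities_mirrors[of m u A] by (simp add: n_def)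
    ultimately show ?thesis using real_arrangement_mirrors(1)[OF L] by blast
  qed
  moreover have "rotation_related A B"
    if A: "real_arrangement A" "first_locus_configuration A" "has_cyclic_multiplicities A m"
      and B: "real_arrangement B" "first_locus_configuration B" "has_cyclic_multiplicities B m" for A B
  proof -
    obtain u where u: "spread n u" "lines_of A = (\<lambda>i. mirror (u i)) ` {..<n}"
        "\<And>i. i < n \<Longrightarrow> A (mirror (u i)) = m ! i"
      using mirrors_of_cyclic_multiplicities[OF A(1,3)] unfolding n_def by blast
    obtain v where v: "spread n v" "lines_of B = (\<lambda>i. mirror (v i)) ` {..<n}"
        "\<And>i. i < n \<Longrightarrow> B (mirror (v i)) = m ! i"
      using mirrors_of_cyclic_multiplicities[OF B(1,3)] unfolding n_def by blast
    have "balanced n k u" "balanced n k v"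
      using first_locus_iff_balanced[OF u(1,2), of k] first_locus_iff_balanced[OF v(1,2), of k]
        u(3) v(3) A(2) B(2)
      by (simp_all add: k_def)
    \<comment> \<open>Index 0 serves as reference: by uniqueness of equilibria all displacements
      equal this one.\<close>
    moreover define c where "c = v 0 - u 0"
    ultimately have "v i - u i = c" if "i < n" for i
      using balanced_unique[OF _ u(1) _ v(1) _ that, of k 0] k1 that by fastforce
    then have v_eq: "v i = u i + c" if "i < n" for i using that by fastforce
    show ?thesis
    proof (rule rotation_related_mirrors[OF u(2)])
      show "lines_of B = (\<lambda>i. mirror (u i + c)) ` {..<n}"
        unfolding v(2) using v_eq by (intro image_cong refl) auto
      show "B (mirror (u i + c)) = A (mirror (u i))" if "i < n" for i
        using v_eq[OF that] u(3)[OF that] v(3)[OF that] by simp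
    qed
  qed
  ultimately show ?thesis by blast
qed

end
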